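(* Let $S$ be a semidomain. Then $S$ is a Goldman-Krull semidomain if and only if the intersection of all nonzero prime ideals of $S$ is not the zero ideal, i.e. \[\bigcap_{P\in \operatorname{Spec}(S)-\{(0)\}} P \neq (0).\]
   Context: A semiring is a set $S$ with two operations $+$ and $\cdot$ such that $(S,+)$ is a commutative monoid with identity $0$, $(S,\cdot)$ is a commutative monoid with identity $1\neq 0$, multiplication distributes over addition, and $s\cdot 0=0$ for all $s\in S$. A semidomain is a semiring $S$ such that $ab=ac$ implies $b=c$ for all $b,c\in S$ and all nonzero $a\in S$. An ideal of $S$ is a nonempty subset $I$ with $a+b\in I$ and $sa\in I$ for all $a,b\in I$, $s\in S$; a proper ideal $P$ (i.e. $P\neq S$) is prime if $ab\in P$ implies $a\in P$ or $b\in P$. $\operatorname{Spec}(S)$ is the set of all prime ideals of $S$. The intersection of the empty family of ideals is $S$. The semifield of fractions $F(S)$ of a semidomain $S$ consists of the fractions $a/b$ with $a,b\in S$, $b\ne 0$, where $a/b=c/d$ iff $ad=bc$, with the usual operations; $S$ is regarded as a subsemiring of $F(S)$. If $S$ is a subsemiring of a semiring $T$ (a subset closed under $+$ and $\cdot$ and containing $0_T,1_T$), then $T$ is a finitely generated semiring over $S$ if there are finitely many elements $t_1,\ldots,t_n\in T$ such that every $x\in T$ has the form $x=s_1x_1+\cdots+s_mx_m$ with $s_i\in S$ and $x_i$ in the multiplicative submonoid of $T$ generated by $t_1,\ldots,t_n$. A semidomain $S$ is a Goldman-Krull semidomain if $F(S)$ is a finitely generated semiring over $S$. *)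

theory Defs
  imports Main
begin

section \<open>Semidomains\<close>

text \<open>A semiring in the sense used here is exactly the library class \<open>comm_semiring_1\<close>:
  both monoids commutative, \<open>0\<close> absorbing and \<open>0 \<noteq> 1\<close>; neither additive
  cancellation nor negatives are assumed.\<close>

class semidomain = comm_semiring_1 +
  assumes semidomain_cancel: "a \<noteq> 0 \<Longrightarrow> a * b = a * c \<Longrightarrow> b = c"
begin

lemma semidomain_mult_nonzero: "a \<noteq> 0 \<Longrightarrow> b \<noteq> 0 \<Longrightarrow> a * b \<noteq> 0"
  using semidomain_cancel [of a b 0] by auto

end


section \<open>Ideals and the prime spectrum\<close>

definition semiring_ideal :: "'a::comm_semiring_1 set \<Rightarrow> bool" where
  "semiring_ideal I \<longleftrightarrow>
     I \<noteq> {} \<and> (\<forall>a\<in>I. \<forall>b\<in>I. a + b \<in> I) \<and> (\<forall>s. \<forall>a\<in>I. s * a \<in> I)"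

definition prime_semiring_ideal :: "'a::comm_semiring_1 set \<Rightarrow> bool" where
  "prime_semiring_ideal P \<longleftrightarrow>
     semiring_ideal P \<and> P \<noteq> UNIV \<and> (\<forall>a b. a * b \<in> P \<longrightarrow> a \<in> P \<or> b \<in> P)"

definition Spec :: "'a::comm_semiring_1 set set" where
  "Spec = {P. prime_semiring_ideal P}"


section \<open>Finitely generated semirings over a subsemiring\<close>

definition subsemiring :: "'t::comm_semiring_1 set \<Rightarrow> bool" where
  "subsemiring S \<longleftrightarrow>
     0 \<in> S \<and> 1 \<in> S \<and> (\<forall>x\<in>S. \<forall>y\<in>S. x + y \<in> S) \<and> (\<forall>x\<in>S. \<forall>y\<in>S. x * y \<in> S)"

inductive_set submonoid_generated :: "'t::comm_monoid_mult set \<Rightarrow> 't set"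
  for G :: "'t set" where
  one: "1 \<in> submonoid_generated G"
| gen: "t \<in> G \<Longrightarrow> t \<in> submonoid_generated G"
| mult: "x \<in> submonoid_generated G \<Longrightarrow> y \<in> submonoid_generated G
           \<Longrightarrow> x * y \<in> submonoid_generated G"

text \<open>The large semiring is the whole type \<open>'t\<close>.\<close>

definition finitely_generated_over :: "'t::comm_semiring_1 set \<Rightarrow> bool" where
  "finitely_generated_over S \<longleftrightarrow>
     subsemiring S \<and>
     (\<exists>G. finite G \<and>
        (\<forall>z. \<exists>(m::nat) s x. (\<forall>i<m. s i \<in> S \<and> x i \<in> submonoid_generated G) \<and>
                            z = (\<Sum>i<m. s i * x i)))"


section \<open>The semifield of fractions\<close>

definition fraction_rel :: "'a::semidomain \<times> 'a \<Rightarrow> 'a \<times> 'a \<Rightarrow> bool" where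
  "fraction_rel p q \<longleftrightarrow>
     snd p \<noteq> 0 \<and> snd q \<noteq> 0 \<and> fst p * snd q = snd p * fst q"

lemma part_equivp_fraction_rel: "part_equivp (fraction_rel :: 'a::semidomain \<times> 'a \<Rightarrow> _)"
proof (rule part_equivpI)
  show "\<exists>p :: 'a \<times> 'a. fraction_rel p p"
    by (rule exI [of _ "(0, 1)"]) (simp add: fraction_rel_def)
  show "symp (fraction_rel :: 'a \<times> 'a \<Rightarrow> _)"
    by (rule sympI) (auto simp: fraction_rel_def mult.commute)
  show "transp (fraction_rel :: 'a \<times> 'a \<Rightarrow> _)"
  proof (rule transpI)
    fix p q r :: "'a \<times> 'a"
    assume pq: "fraction_rel p q" and qr: "fraction_rel q r"
    have "snd q * (fst p * snd r) = (fst p * snd q) * snd r"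
      by (simp add: ac_simps)
    also have "\<dots> = snd p * (fst q * snd r)"
      using pq by (simp add: fraction_rel_def ac_simps)
    also have "\<dots> = snd q * (snd p * fst r)"
      using qr by (simp add: fraction_rel_def ac_simps)
    finally have "fst p * snd r = snd p * fst r"
      using pq semidomain_cancel unfolding fraction_rel_def by blast
    then show "fraction_rel p r"
      using pq qr by (simp add: fraction_rel_def)
  qed
qed

quotient_type (overloaded) 'a fractions = "'a::semidomain \<times> 'a" / partial: fraction_rel
  by (rule part_equivp_fraction_rel)

instantiation fractions :: (semidomain) comm_semiring_1
begin

lift_definition zero_fractions :: "'a fractions" is "(0, 1)"
  by (simp add: fraction_rel_def)

lift_definition one_fractions :: "'a fractions" is "(1, 1)"
  by (simp add: fraction_rel_def)

lift_definition plus_fractions :: "'a fractions \<Rightarrow> 'a fractions \<Rightarrow> 'a fractions"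
  is "\<lambda>p q. (fst p * snd q + snd p * fst q, snd p * snd q)"
proof -
  fix p p' q q' :: "'a \<times> 'a"
  assume p: "fraction_rel p p'" and q: "fraction_rel q q'"
  have "(fst p * snd q + snd p * fst q) * (snd p' * snd q') =
      (fst p * snd p') * (snd q * snd q') + (fst q * snd q') * (snd p * snd p')"
    by (simp add: algebra_simps)
  also have "\<dots> = (snd p * fst p') * (snd q * snd q') + (snd q * fst q') * (snd p * snd p')"
    using p q by (simp add: fraction_rel_def)
  also have "\<dots> = (snd p * snd q) * (fst p' * snd q' + snd p' * fst q')"
    by (simp add: algebra_simps)
  finally show "fraction_rel (fst p * snd q + snd p * fst q, snd p * snd q)
      (fst p' * snd q' + snd p' * fst q', snd p' * snd q')"
    using p q by (simp add: fraction_rel_def semidomain_mult_nonzero)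
qed

lift_definition times_fractions :: "'a fractions \<Rightarrow> 'a fractions \<Rightarrow> 'a fractions"
  is "\<lambda>p q. (fst p * fst q, snd p * snd q)"
proof -
  fix p p' q q' :: "'a \<times> 'a"
  assume p: "fraction_rel p p'" and q: "fraction_rel q q'"
  have "(fst p * fst q) * (snd p' * snd q') = (fst p * snd p') * (fst q * snd q')"
    by (simp add: ac_simps)
  also have "\<dots> = (snd p * fst p') * (snd q * fst q')"
    using p q by (simp add: fraction_rel_def)
  also have "\<dots> = (snd p * snd q) * (fst p' * fst q')"
    by (simp add: ac_simps)
  finally show "fraction_rel (fst p * fst q, snd p * snd q) (fst p' * fst q', snd p' * snd q')"
    using p q by (simp add: fraction_rel_def semidomain_mult_nonzero)
qed

instance
  by (standard; transfer)
    (auto simp: fraction_rel_def semidomain_mult_nonzero algebra_simps)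

end

text \<open>The fraction \<open>a / b\<close>; the value for \<open>b = 0\<close> is irrelevant.\<close>

lift_definition fraction :: "'a::semidomain \<Rightarrow> 'a \<Rightarrow> 'a fractions"
  is "\<lambda>a b. if b = 0 then (0, 1) else (a, b)"
  by (simp add: fraction_rel_def mult.commute)

lemma fraction_eq_iff:
  "b \<noteq> 0 \<Longrightarrow> d \<noteq> 0 \<Longrightarrow> fraction a b = fraction c d \<longleftrightarrow> a * d = b * c"
  by transfer (simp add: fraction_rel_def)

lemma fractions_cases:
  obtains a b where "b \<noteq> 0" "x = fraction a b"
proof -
  have "\<exists>a b. b \<noteq> 0 \<and> x = fraction a b"
    by transfer (force simp: fraction_rel_def mult.commute)
  then show ?thesis using that by blast
qed

lemma fraction_add:
  "b \<noteq> 0 \<Longrightarrow> d \<noteq> 0 \<Longrightarrow> fraction a b + fraction c d = fraction (a * d + b * c) (b * d)"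
  by transfer (simp add: fraction_rel_def semidomain_mult_nonzero ac_simps)

lemma fraction_mult:
  "b \<noteq> 0 \<Longrightarrow> d \<noteq> 0 \<Longrightarrow> fraction a b * fraction c d = fraction (a * c) (b * d)"
  by transfer (simp add: fraction_rel_def semidomain_mult_nonzero ac_simps)

lemma zero_fraction: "0 = fraction 0 1"
  by transfer (simp add: fraction_rel_def)

lemma one_fraction: "1 = fraction 1 1"
  by transfer (simp add: fraction_rel_def)

text \<open>The canonical embedding, through which \<open>S\<close> is regarded as a subsemiring of \<open>F(S)\<close>.\<close>

definition to_fractions :: "'a::semidomain \<Rightarrow> 'a fractions" where
  "to_fractions a = fraction a 1"

lemma inj_to_fractions: "inj to_fractions"
  by (rule injI) (simp add: to_fractions_def fraction_eq_iff)

lemma to_fractions_simps [simp]: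
  "to_fractions 0 = 0"
  "to_fractions 1 = 1"
  "to_fractions (a + b) = to_fractions a + to_fractions b"
  "to_fractions (a * b) = to_fractions a * to_fractions b"
  by (simp_all add: to_fractions_def zero_fraction one_fraction fraction_add fraction_mult)

lemma subsemiring_range_to_fractions: "subsemiring (range to_fractions)"
  unfolding subsemiring_def
  by (auto simp flip: to_fractions_simps)

definition Goldman_Krull :: "'a::semidomain itself \<Rightarrow> bool" where
  "Goldman_Krull _ \<longleftrightarrow>
     finitely_generated_over (range (to_fractions :: 'a \<Rightarrow> 'a fractions))"

end

theory Submission imports Defs
begin

text \<open>If \<open>F(S)\<close> is generated over \<open>S\<close> by finitely many fractions and \<open>u \<noteq> 0\<close> is a common
  denominator of them, then every fraction is of the form \<open>s / u\<^sup>k\<close>. For a nonzero element \<open>p\<close>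
  of a prime ideal \<open>P\<close>, writing \<open>1 / p\<close> in this form gives \<open>u\<^sup>k \<in> P\<close>, hence \<open>u \<in> P\<close>.
  Conversely, let \<open>u \<noteq> 0\<close> lie in all nonzero prime ideals. An ideal maximal among those that
  contain a given \<open>b \<noteq> 0\<close> and avoid the powers of \<open>u\<close> would be a nonzero prime not containing
  \<open>u\<close>; so \<open>b\<close> divides a power of \<open>u\<close>, and \<open>1 / u\<close> alone generates \<open>F(S)\<close>.\<close>


section \<open>Ideals avoiding a multiplicative set\<close>

lemma semiring_ideal_zero: "semiring_ideal I \<Longrightarrow> 0 \<in> I"
  unfolding semiring_ideal_def by (metis equals0I mult_zero_left)

lemma semiring_ideal_add: "semiring_ideal I \<Longrightarrow> a \<in> I \<Longrightarrow> b \<in> I \<Longrightarrow> a + b \<in> I"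
  by (simp add: semiring_ideal_def)

lemma semiring_ideal_mult_left: "semiring_ideal I \<Longrightarrow> a \<in> I \<Longrightarrow> s * a \<in> I"
  by (simp add: semiring_ideal_def)

lemma semiring_ideal_mult_right: "semiring_ideal I \<Longrightarrow> a \<in> I \<Longrightarrow> a * s \<in> I"
  by (subst mult.commute) (rule semiring_ideal_mult_left)

lemma semiring_ideal_multiples: "semiring_ideal (range ((*) a))"
  unfolding semiring_ideal_def
proof (intro conjI ballI allI)
  fix x y assume "x \<in> range ((*) a)" "y \<in> range ((*) a)"
  then show "x + y \<in> range ((*) a)"
    by (auto simp flip: distrib_left)
next
  fix s x assume "x \<in> range ((*) a)"
  then obtain c where "x = a * c" by blast
  then have "s * x = a * (s * c)"
    by (simp add: mult.left_commute)
  then show "s * x \<in> range ((*) a)" by blast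
qed simp

text \<open>This is the smallest ideal containing \<open>I\<close> and \<open>a\<close>, against
  which maximality is tested below.\<close>

lemma semiring_ideal_adjoin:
  assumes I: "semiring_ideal I"
  shows "semiring_ideal {p + s * a |p s. p \<in> I}" (is "semiring_ideal ?J")
  unfolding semiring_ideal_def
proof (intro conjI ballI allI)
  show "?J \<noteq> {}"
    using semiring_ideal_zero [OF I] by blast
next
  fix x y assume "x \<in> ?J" "y \<in> ?J"
  then obtain p s q t where "x = p + s * a" "p \<in> I" "y = q + t * a" "q \<in> I"
    by blast
  then have "x + y = (p + q) + (s + t) * a" "p + q \<in> I"
    using I by (simp_all add: semiring_ideal_add algebra_simps)
  then show "x + y \<in> ?J" by blast
next
  fix r x assume "x \<in> ?J"
  then obtain p s where "x = p + s * a" "p \<in> I"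
    by blast
  then have "r * x = r * p + (r * s) * a" "r * p \<in> I"
    using I by (simp_all add: semiring_ideal_mult_left distrib_left mult.assoc)
  then show "r * x \<in> ?J" by blast
qed

text \<open>Two elements of the union already lie together in the larger of two comparable members.
  \<open>C\<close> must be nonempty because the empty union is not an ideal.\<close>

lemma semiring_ideal_Union_chain:
  assumes "C \<noteq> {}" "subset.chain {I. semiring_ideal I} C"
  shows "semiring_ideal (\<Union>C)"
  unfolding semiring_ideal_def
proof (intro conjI ballI allI)
  have ideal: "I \<in> C \<Longrightarrow> semiring_ideal I" for I
    using assms by (auto simp: subset.chain_def)
  show "\<Union>C \<noteq> {}"
    using assms(1) ideal semiring_ideal_zero by blast
  show "s * x \<in> \<Union>C" if "x \<in> \<Union>C" for s x
    using that ideal semiring_ideal_mult_left by blast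
  show "x + y \<in> \<Union>C" if xy: "x \<in> \<Union>C" "y \<in> \<Union>C" for x y
  proof -
    obtain I J where "I \<in> C" "x \<in> I" "J \<in> C" "y \<in> J"
      using xy by blast
    moreover from this have "I \<subseteq> J \<or> J \<subseteq> I"
      using assms(2) by (auto simp: subset_chain_def)
    ultimately obtain K where "K \<in> C" "x \<in> K" "y \<in> K"
      by blast
    then show ?thesis
      using ideal semiring_ideal_add by blast
  qed
qed

text \<open>Krull's argument: by Zorn's lemma there is a maximal ideal among those containing
  \<open>I\<close> and disjoint from \<open>M\<close>, and maximality makes it prime. It is proper
  since \<open>1\<close> lies in \<open>M\<close>.\<close>

lemma prime_semiring_ideal_avoiding:
  assumes I: "semiring_ideal I" and disj: "I \<inter> M = {}"
    and one: "1 \<in> M" and mult: "\<And>x y. x \<in> M \<Longrightarrow> y \<in> M \<Longrightarrow> x * y \<in> M"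
  obtains P where "prime_semiring_ideal P" "I \<subseteq> P" "P \<inter> M = {}"
proof -
  define A where "A = {J. semiring_ideal J \<and> I \<subseteq> J \<and> J \<inter> M = {}}"
  have "\<exists>P\<in>A. \<forall>X\<in>A. P \<subseteq> X \<longrightarrow> X = P"
  proof (rule subset_Zorn_nonempty)
    show "A \<noteq> {}"
      using I disj by (auto simp: A_def)
    fix C assume C: "C \<noteq> {}" "subset.chain A C"
    then have "semiring_ideal (\<Union>C)"
      by (intro semiring_ideal_Union_chain) (auto simp: subset_chain_def A_def)
    then show "\<Union>C \<in> A"
      using C by (auto simp: A_def subset_chain_def)
  qed
  then obtain P where P: "semiring_ideal P" "I \<subseteq> P" "P \<inter> M = {}"
    and max: "\<And>J. semiring_ideal J \<Longrightarrow> P \<subseteq> J \<Longrightarrow> J \<inter> M = {} \<Longrightarrow> J = P"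
    unfolding A_def by (smt (verit) mem_Collect_eq order_trans)
  \<comment> \<open>Adjoining such an \<open>a\<close> enlarges \<open>P\<close> strictly, so by
    maximality the new ideal meets \<open>M\<close>.\<close>
  have meets: "\<exists>p s. p \<in> P \<and> p + s * a \<in> M" if "a \<notin> P" for a
  proof (rule ccontr)
    let ?J = "{p + s * a |p s. p \<in> P}"
    assume "\<not> ?thesis"
    then have "?J \<inter> M = {}" by blast
    moreover have "P \<subseteq> ?J"
    proof
      fix p assume "p \<in> P"
      moreover have "p = p + 0 * a" by simp
      ultimately show "p \<in> ?J" by blast
    qed
    ultimately have "?J = P"
      by (intro max semiring_ideal_adjoin P)
    moreover have "a = 0 + 1 * a" by simp
    then have "a \<in> ?J"
      using semiring_ideal_zero [OF P(1)] by blast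
    ultimately show False using that by blast
  qed
  have "a \<in> P \<or> b \<in> P" if ab: "a * b \<in> P" for a b
  proof (rule ccontr)
    assume "\<not> ?thesis"
    then obtain p s q t where pq: "p \<in> P" "q \<in> P" and "p + s * a \<in> M" "q + t * b \<in> M"
      using meets by metis
    then have "(p + s * a) * (q + t * b) \<in> M"
      by (intro mult)
    \<comment> \<open>Each summand is a multiple of \<open>p\<close>, \<open>q\<close> or
      \<open>a * b\<close>; no subtraction is involved, so the ring argument carries over.\<close>
    moreover have "(p + s * a) * (q + t * b) = p * (q + t * b) + ((s * a) * q + (s * t) * (a * b))"
      by (simp add: algebra_simps)
    moreover have "\<dots> \<in> P"
      using P(1) pq ab
      by (intro semiring_ideal_add) (auto intro: semiring_ideal_mult_left semiring_ideal_mult_right)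
    ultimately show False
      using P(3) by auto
  qed
  then have "prime_semiring_ideal P"
    using P one by (auto simp: prime_semiring_ideal_def)
  then show ?thesis
    using that P by blast
qed

lemma prime_semiring_ideal_one_notin: "prime_semiring_ideal P \<Longrightarrow> 1 \<notin> P"
  using semiring_ideal_mult_left [of P 1] by (auto simp: prime_semiring_ideal_def)

lemma prime_semiring_ideal_power:
  assumes "prime_semiring_ideal P" "u ^ n \<in> P"
  shows "u \<in> P"
  using assms(2)
proof (induction n)
  case 0
  then show ?case
    using prime_semiring_ideal_one_notin [OF assms(1)] by simp
next
  case (Suc n)
  then show ?case
    using assms(1) by (auto simp: prime_semiring_ideal_def)
qed


section \<open>Fractions with a common denominator\<close>

lemma to_fractions_eq_iff: "to_fractions a = to_fractions b \<longleftrightarrow> a = b"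
  using inj_to_fractions by (auto dest: injD)

lemma fraction_mult_denominator: "b \<noteq> 0 \<Longrightarrow> fraction a b * to_fractions b = to_fractions a"
  by (simp add: to_fractions_def fraction_mult fraction_eq_iff mult.commute)

lemma prod_nonzero_semidomain:
  fixes f :: "'b \<Rightarrow> 'a::semidomain"
  assumes "\<And>x. x \<in> A \<Longrightarrow> f x \<noteq> 0"
  shows "prod f A \<noteq> 0"
  using assms by (induction A rule: infinite_finite_induct) (simp_all add: semidomain_mult_nonzero)

lemma power_nonzero_semidomain: "u \<noteq> 0 \<Longrightarrow> u ^ n \<noteq> (0 :: 'a::semidomain)"
  by (induction n) (simp_all add: semidomain_mult_nonzero)

text \<open>The product of one chosen denominator for each element of \<open>G\<close> clears all of
  them.\<close>

lemma common_denominator: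
  fixes G :: "'a::semidomain fractions set"
  assumes "finite G"
  obtains u where "u \<noteq> 0" "\<And>g. g \<in> G \<Longrightarrow> g * to_fractions u \<in> range to_fractions"
proof -
  have "\<exists>b a. b \<noteq> 0 \<and> g * to_fractions b = to_fractions a" for g :: "'a fractions"
    by (cases g rule: fractions_cases) (metis fraction_mult_denominator)
  then obtain d n where d: "\<And>g. d g \<noteq> (0 :: 'a)" "\<And>g. g * to_fractions (d g) = to_fractions (n g)"
    by metis
  show ?thesis
  proof
    show "prod d G \<noteq> 0"
      using d(1) by (rule prod_nonzero_semidomain)
    fix g assume "g \<in> G"
    with assms have "prod d G = d g * prod d (G - {g})"
      by (rule prod.remove)
    then have "g * to_fractions (prod d G) = (g * to_fractions (d g)) * to_fractions (prod d (G - {g}))"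
      by (simp add: mult.assoc)
    also have "\<dots> = to_fractions (n g * prod d (G - {g}))"
      using d(2) by simp
    finally show "g * to_fractions (prod d G) \<in> range to_fractions"
      by blast
  qed
qed

text \<open>The localization \<open>S[1/u]\<close> inside \<open>F(S)\<close>, for \<open>u \<noteq> 0\<close>.\<close>

definition power_fractions :: "'a::semidomain \<Rightarrow> 'a fractions set" where
  "power_fractions u = {z. \<exists>k s. z * to_fractions (u ^ k) = to_fractions s}"

lemma power_fractions_to_fractions: "to_fractions s \<in> power_fractions u"
proof -
  have "to_fractions s * to_fractions (u ^ 0) = to_fractions s"
    by simp
  then show ?thesis
    unfolding power_fractions_def by blast
qed

lemma power_fractions_mult:
  assumes "x \<in> power_fractions u" "y \<in> power_fractions u"
  shows "x * y \<in> power_fractions u"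
proof -
  obtain k s l t where *: "x * to_fractions (u ^ k) = to_fractions s" "y * to_fractions (u ^ l) = to_fractions t"
    using assms by (auto simp: power_fractions_def)
  have "x * y * to_fractions (u ^ (k + l)) = (x * to_fractions (u ^ k)) * (y * to_fractions (u ^ l))"
    by (simp add: power_add ac_simps)
  also have "\<dots> = to_fractions (s * t)"
    by (simp only: * to_fractions_simps)
  finally show ?thesis
    unfolding power_fractions_def by blast
qed

lemma power_fractions_add:
  assumes "x \<in> power_fractions u" "y \<in> power_fractions u"
  shows "x + y \<in> power_fractions u"
proof -
  obtain k s l t where *: "x * to_fractions (u ^ k) = to_fractions s" "y * to_fractions (u ^ l) = to_fractions t"
    using assms by (auto simp: power_fractions_def)
  have "(x + y) * to_fractions (u ^ (k + l)) =
      (x * to_fractions (u ^ k)) * to_fractions (u ^ l) + (y * to_fractions (u ^ l)) * to_fractions (u ^ k)"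
    by (simp add: power_add algebra_simps)
  also have "\<dots> = to_fractions (s * u ^ l + t * u ^ k)"
    by (simp only: * to_fractions_simps)
  finally show ?thesis
    unfolding power_fractions_def by blast
qed

lemma power_fractions_sum:
  "(\<And>i. i \<in> A \<Longrightarrow> f i \<in> power_fractions u) \<Longrightarrow> sum f A \<in> power_fractions u"
proof (induction A rule: infinite_finite_induct)
  case (insert i A)
  then show ?case by (simp add: power_fractions_add)
\<comment> \<open>The sum over an infinite index set is 0 by convention, as is the empty
  sum.\<close>
qed (use power_fractions_to_fractions [of 0 u] in simp_all)

text \<open>The unit needs exponent 0, a generator exponent 1, and exponents add under
  products.\<close>

lemma power_fractions_submonoid_generated:
  assumes G: "\<And>g. g \<in> G \<Longrightarrow> g * to_fractions u \<in> range to_fractions"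
    and x: "x \<in> submonoid_generated G"
  shows "x \<in> power_fractions u"
  using x
proof induction
  case one
  show ?case using power_fractions_to_fractions [of 1 u] by simp
next
  case (gen t)
  show ?case
  proof -
    obtain s where "t * to_fractions (u ^ 1) = to_fractions s"
      using G [OF gen] by auto
    then show ?thesis
      unfolding power_fractions_def by blast
  qed
next
  case (mult x y)
  then show ?case by (simp add: power_fractions_mult)
qed

text \<open>For a common denominator \<open>u\<close> of the generators,
  \<open>power_fractions u\<close> contains the coefficients and all monomials in the generators.
  Being closed under sums and products, it contains every fraction.\<close>

lemma Goldman_Krull_imp_power_fractions:
  assumes "Goldman_Krull TYPE('a::semidomain)"
  obtains u :: "'a::semidomain" where "u \<noteq> 0" "power_fractions u = UNIV"
proof -
  obtain G :: "'a fractions set" where "finite G"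
    and gen: "\<And>z. \<exists>(m::nat) s x. (\<forall>i<m. s i \<in> range to_fractions \<and> x i \<in> submonoid_generated G) \<and>
                            z = (\<Sum>i<m. s i * x i)"
    using assms by (auto simp: Goldman_Krull_def finitely_generated_over_def)
  then obtain u where u: "u \<noteq> 0" "\<And>g. g \<in> G \<Longrightarrow> g * to_fractions u \<in> range to_fractions"
    using common_denominator by blast
  have "z \<in> power_fractions u" for z
  proof -
    obtain m :: nat and s x where *: "\<forall>i<m. s i \<in> range to_fractions \<and> x i \<in> submonoid_generated G"
      and z: "z = (\<Sum>i<m. s i * x i)"
      using gen [of z] by (elim exE conjE)
    have "s i \<in> power_fractions u" if "i < m" for i
      using * that power_fractions_to_fractions [of _ u] by (metis imageE)
    moreover have "x i \<in> power_fractions u" if "i < m" for i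
      using * that by (intro power_fractions_submonoid_generated [OF u(2)]) auto
    ultimately show ?thesis
      unfolding z by (intro power_fractions_sum power_fractions_mult) auto
  qed
  then show ?thesis
    using that u(1) by blast
qed

lemma submonoid_generated_power: "t \<in> G \<Longrightarrow> t ^ n \<in> submonoid_generated G"
  by (induction n) (auto intro: submonoid_generated.intros)

text \<open>If \<open>u ^ n = b * c\<close>, then \<open>a / b = (a * c) * (1 / u) ^ n\<close>: one
  generator and a one-term sum suffice.\<close>

lemma Goldman_Krull_if_divides_power:
  fixes u :: "'a::semidomain"
  assumes u: "u \<noteq> 0" and dvd: "\<And>b. b \<noteq> 0 \<Longrightarrow> \<exists>n. b dvd u ^ n"
  shows "Goldman_Krull TYPE('a)"
proof -
  let ?t = "fraction 1 u"
  have "\<exists>(m::nat) s x. (\<forall>i<m. s i \<in> range to_fractions \<and> x i \<in> submonoid_generated {?t}) \<and>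
      z = (\<Sum>i<m. s i * x i)" for z
  proof -
    obtain a b where b: "b \<noteq> 0" and z: "z = fraction a b"
      by (rule fractions_cases)
    obtain n c where c: "u ^ n = b * c"
      using dvd [OF b] by blast
    have "?t ^ k = fraction 1 (u ^ k)" for k
      using u by (induction k) (simp_all add: one_fraction fraction_mult power_nonzero_semidomain)
    then have t: "?t ^ n = fraction 1 (b * c)"
      by (simp add: c)
    \<comment> \<open>\<open>fraction\<close> has a default value at denominator 0, so comparing
      fractions requires this.\<close>
    have "b * c \<noteq> 0"
      using power_nonzero_semidomain [OF u, of n] by (simp add: c)
    then have "z = to_fractions (a * c) * ?t ^ n"
      using b by (simp del: to_fractions_simps
          add: t z to_fractions_def fraction_mult fraction_eq_iff ac_simps)
    then have "z = (\<Sum>i<Suc 0. to_fractions (a * c) * ?t ^ n)"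
      by simp
    moreover have "\<forall>i<Suc 0. to_fractions (a * c) \<in> range to_fractions \<and> ?t ^ n \<in> submonoid_generated {?t}"
      by (simp only: rangeI submonoid_generated_power insertI1 simp_thms)
    ultimately show ?thesis
      by (intro exI [of _ "Suc 0"] exI [of _ "\<lambda>_. to_fractions (a * c)"] exI [of _ "\<lambda>_. ?t ^ n"] conjI)
  qed
  moreover have "finite {?t}"
    by simp
  ultimately show ?thesis
    unfolding Goldman_Krull_def finitely_generated_over_def
    by (intro conjI exI [of _ "{?t}"] allI subsemiring_range_to_fractions)
qed


section \<open>The intersection of the nonzero prime ideals\<close>

lemma nonzero_prime_contains_denominator:
  assumes all: "power_fractions u = UNIV" and P: "prime_semiring_ideal P" "P \<noteq> {0}"
  shows "u \<in> P"
proof -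
  have ideal: "semiring_ideal P"
    using P(1) by (simp add: prime_semiring_ideal_def)
  then obtain p where p: "p \<in> P" "p \<noteq> 0"
    using P(2) semiring_ideal_zero by blast
  obtain k s where ks: "fraction 1 p * to_fractions (u ^ k) = to_fractions s"
    using all unfolding power_fractions_def by blast
  \<comment> \<open>Multiplying \<open>1 / p = s / u ^ k\<close> by \<open>p\<close> and
    \<open>u ^ k\<close> clears both denominators; injectivity of the embedding then brings the
    equation back to the semidomain.\<close>
  have "to_fractions (u ^ k) = (fraction 1 p * to_fractions p) * to_fractions (u ^ k)"
    using p(2) by (simp add: fraction_mult_denominator)
  also have "\<dots> = (fraction 1 p * to_fractions (u ^ k)) * to_fractions p"
    by (simp add: ac_simps)
  also have "\<dots> = to_fractions (s * p)"
    by (simp add: ks)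
  finally have "u ^ k = s * p"
    by (simp only: to_fractions_eq_iff)
  then have "u ^ k \<in> P"
    using ideal p(1) by (simp add: semiring_ideal_mult_left)
  then show ?thesis
    using P(1) prime_semiring_ideal_power by blast
qed

text \<open>If \<open>b\<close> divides no power of \<open>u\<close>, its principal ideal avoids
  these powers and extends to a prime ideal avoiding them, contrary to the assumption on
  \<open>u\<close>.\<close>

lemma dvd_power_if_in_nonzero_primes:
  assumes u: "\<And>P. prime_semiring_ideal P \<Longrightarrow> P \<noteq> {0} \<Longrightarrow> u \<in> P" and b: "b \<noteq> 0"
  shows "\<exists>n. b dvd u ^ n"
proof (rule ccontr)
  assume "\<not> ?thesis"
  then have "range ((*) b) \<inter> range ((^) u) = {}"
    by (auto simp: dvd_def) metis
  then obtain P where P: "prime_semiring_ideal P" "range ((*) b) \<subseteq> P" "P \<inter> range ((^) u) = {}"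
  proof (rule prime_semiring_ideal_avoiding [OF semiring_ideal_multiples])
    show "1 \<in> range ((^) u)"
      by (rule range_eqI [of _ _ 0]) simp
    show "x * y \<in> range ((^) u)" if "x \<in> range ((^) u)" "y \<in> range ((^) u)" for x y
      using that by (auto simp flip: power_add)
  qed
  \<comment> \<open>Thus \<open>b\<close> lies in \<open>P\<close>, which shows that
    \<open>P\<close> is not the zero ideal.\<close>
  have "b * 1 \<in> P"
    using P(2) by blast
  then have "u \<in> P"
    using b P(1) by (intro u) auto
  moreover have "u \<in> range ((^) u)"
    by (rule range_eqI [of _ _ 1]) simp
  ultimately show False
    using P(3) by blast
qed

theorem corollary6p6:
  shows "Goldman_Krull TYPE('a::semidomain) \<longleftrightarrow>
    (\<Inter>P \<in> Spec - {{0}}. P) \<noteq> {0 :: 'a}"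
proof
  assume "Goldman_Krull TYPE('a)"
  then obtain u :: 'a where "u \<noteq> 0" "power_fractions u = UNIV"
    by (rule Goldman_Krull_imp_power_fractions)
  then have "u \<in> (\<Inter>P \<in> Spec - {{0}}. P)"
    by (auto simp: Spec_def intro: nonzero_prime_contains_denominator)
  with \<open>u \<noteq> 0\<close> show "(\<Inter>P \<in> Spec - {{0}}. P) \<noteq> {0 :: 'a}"
    by blast
next
  assume ne: "(\<Inter>P \<in> Spec - {{0}}. P) \<noteq> {0 :: 'a}"
  \<comment> \<open>With 0 present, differing from \<open>{0}\<close> means having a nonzero
    element. This includes the case without nonzero primes, where the intersection is
    \<open>UNIV\<close>.\<close>
  have "0 \<in> (\<Inter>P \<in> Spec - {{0 :: 'a}}. P)"
    by (auto simp: Spec_def prime_semiring_ideal_def semiring_ideal_zero)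
  with ne obtain u :: 'a where "u \<noteq> 0" "u \<in> (\<Inter>P \<in> Spec - {{0}}. P)"
    by blast
  then have "u \<noteq> 0" "\<And>P. prime_semiring_ideal P \<Longrightarrow> P \<noteq> {0} \<Longrightarrow> u \<in> P"
    by (auto simp: Spec_def)
  then show "Goldman_Krull TYPE('a)"
    by (intro Goldman_Krull_if_divides_power dvd_power_if_in_nonzero_primes) auto
qed

end
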